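(* Let $\mathfrak{R}:\mathcal{L}_2\rightrightarrows\mathcal{L}_2$ be a reset system with data $(A,B,C,D,R,M)$ as described in the context. Let $\tilde{\mathbf{\Pi}}\subset\mathbf{\Pi}(\mathfrak{R})$, let $\mathcal{S}_{\mathrm{SG}}:=\bigcap_{\Pi\in\tilde{\mathbf{\Pi}}}\mathcal{S}(\Pi)$ be the corresponding over-bound of $\mathrm{SG}(\mathfrak{R})$, and let $\mathcal{U}\subset\mathcal{L}_2\setminus\{0\}$ be a set of inputs with set of samples $\mathcal{Z}(\mathfrak{R},\mathcal{U})$. If $$\text{h-hull}\big(\mathcal{Z}(\mathfrak{R},\mathcal{U})\big)=\mathcal{S}_{\mathrm{SG}},$$ then $\mathcal{S}_{\mathrm{SG}}$ is the minimal achievable over-bound of $\mathrm{SG}(\mathfrak{R})$ using quadratic dissipativity; that is, for every set $\tilde{\mathbf{\Pi}}'\subset\mathbf{\Pi}(\mathfrak{R})$, $$\mathcal{S}_{\mathrm{SG}}\subset\bigcap_{\Pi\in\tilde{\mathbf{\Pi}}'}\mathcal{S}(\Pi).$$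
   Context: Signals: $\mathcal{L}_2$ is the space of functions $u:\mathbb{R}_{\ge0}\to\mathbb{R}^p$ with $\int_0^\infty u^\top(t)u(t)\,dt<\infty$, with inner product $\langle u,y\rangle=\int_0^\infty u^\top(t)y(t)\,dt$ and norm $\|u\|=\sqrt{\langle u,u\rangle}$. Reset system: $\mathfrak{R}$ is given by $\dot x(t)=Ax(t)+Bu(t)$ if $x(t)\in\mathcal{F}$; $x(t^+)=Rx(t)$ if $x(t)\in\mathcal{J}$; $y(t)=Cx(t)+Du(t)$, with state $x(t)\in\mathbb{R}^n$, $x(0)=0$, input $u(t)\in\mathbb{R}^p$, output $y(t)\in\mathbb{R}^p$, $x(t^+)=\lim_{s\downarrow t}x(s)$, real matrices $A,B,C,D,R$ of compatible sizes, $\mathcal{F}=\{\mu\in\mathbb{R}^n\mid \mu^\top M\mu\ge0\}$, $\mathcal{J}=\{\mu\in\mathbb{R}^n\mid\mu^\top M\mu<0\}$, and $M$ a real symmetric $n\times n$ matrix. We write $y\in\mathfrak{R}u$ if $y$ is a (possibly non-unique) output of $\mathfrak{R}$ resulting from input $u$. Standing assumption: for inputs $u\in\mathcal{L}_2$ the system exhibits no Zeno behavior (no infinite number of resets in a finite time interval), and $x,y\in\mathcal{L}_2$ and $\lim_{t\to\infty}x(t)=0$. Scaled graph: for $u\in\mathcal{L}_2\setminus\{0\}$ let $z(u,\mathfrak{R})=\{\rho(u,y)e^{\pm j\theta(u,y)}\mid y\in\mathfrak{R}u\}\subset\mathbb{C}$ ($j$ the imaginary unit), where $\rho(u,y)=\|y\|/\|u\|$,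 $\theta(u,y)=\arccos\big(\langle u,y\rangle/(\|u\|\|y\|)\big)$ if $y\ne0$ and $\theta(u,y)=0$ if $y=0$. Then $\mathrm{SG}(\mathfrak{R})$ is the union of the sets $z(u,\mathfrak{R})$ over $u\in\mathcal{L}_2\setminus\{0\}$. For a set of inputs $\mathcal{U}$, the set of samples $\mathcal{Z}(\mathfrak{R},\mathcal{U})$ is the union of the sets $z(u,\mathfrak{R})$ over $u\in\mathcal{U}$. Quadratic dissipativity: $\mathbb{S}^2$ denotes the real symmetric $2\times2$ matrices. $\mathbf{\Pi}(\mathfrak{R})$ is the set of $\Pi\in\mathbb{S}^2$ such that $\int_0^\infty\begin{bmatrix}y(t)\\ u(t)\end{bmatrix}^\top(\Pi\otimes I_p)\begin{bmatrix}y(t)\\ u(t)\end{bmatrix}dt\ge0$ for all $u\in\mathcal{L}_2$ and $y\in\mathfrak{R}u$, where $\otimes$ is the Kronecker product. For $\Pi\in\mathbb{S}^2$, $\mathcal{S}(\Pi)=\left\{z\in\mathbb{C}\,\middle|\,\begin{bmatrix}z\\1\end{bmatrix}^*\Pi\begin{bmatrix}z\\1\end{bmatrix}\ge0\right\}$. An over-bound of $\mathrm{SG}(\mathfrak{R})$ obtained using quadratic dissipativity is a set of the form $\bigcap_{\Pi\in\tilde{\mathbf{\Pi}}}\mathcal{S}(\Pi)$ with $\tilde{\mathbf{\Pi}}\subset\mathbf{\Pi}(\mathfrak{R})$. An intersection over the empty family is $\mathbb{C}$. Hyperbolic convexity: $\mathbb{C}_+$ and $\mathbb{C}_-$ are the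 complex numbers with non-negative, respectively non-positive, imaginary part, and $\mathrm{conj}(\mathcal{X})=\{\bar x\mid x\in\mathcal{X}\}$. For $z_1,z_2\in\mathbb{C}_+$, $\mathrm{ARC}_{\min}(z_1,z_2)\subset\mathbb{C}_+$ is the geodesic between them under the Poincaré metric: the section in $\mathbb{C}_+$, with endpoints $z_1,z_2$, of the circle centered on the real axis through $z_1,z_2$ (the vertical segment from $z_1$ to $z_2$ if they have equal real parts). A set $\mathcal{C}\subset\mathbb{C}_+$ is h-convex if $z_1,z_2\in\mathcal{C}$ implies $\mathrm{ARC}_{\min}(z_1,z_2)\subset\mathcal{C}$; the h-convex hull $\text{h-hull}(\mathcal{C})$ of $\mathcal{C}\subset\mathbb{C}_+$ is the smallest h-convex set containing $\mathcal{C}$. For a set $\mathcal{C}\subset\mathbb{C}$ symmetric about the real axis (i.e. $\mathcal{C}\cap\mathbb{C}_+=\mathrm{conj}(\mathcal{C}\cap\mathbb{C}_-)$), such as $\mathcal{Z}(\mathfrak{R},\mathcal{U})$, one sets $\text{h-hull}(\mathcal{C}):=\text{h-hull}(\mathcal{C}\cap\mathbb{C}_+)\cup\mathrm{conj}(\text{h-hull}(\mathcal{C}\cap\mathbb{C}_+))$. *)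

theory Defs
  imports "HOL-Analysis.Analysis"
begin

section \<open>Signals\<close>

text \<open>
  A signal on the half line is a function on the reals of which only the values at \<open>t \<ge> 0\<close>
  are ever used.  Signals are functions rather than classes of functions, so being (non)zero as an
  element of \<open>L2\<close> is expressed by the norm.
\<close>

definition L2_signals :: "(real \<Rightarrow> real ^ 'p) set" where
  "L2_signals = {u. u \<in> borel_measurable (lebesgue_on {0..}) \<and>
                    integrable (lebesgue_on {0..}) (\<lambda>t. u t \<bullet> u t)}"

definition L2_inner :: "(real \<Rightarrow> real ^ 'p) \<Rightarrow> (real \<Rightarrow> real ^ 'p) \<Rightarrow> real" where
  "L2_inner u y = (LINT t|lebesgue_on {0..}. u t \<bullet> y t)"

definition L2_norm :: "(real \<Rightarrow> real ^ 'p) \<Rightarrow> real" where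
  "L2_norm u = sqrt (L2_inner u u)"

definition L2_nonzero :: "(real \<Rightarrow> real ^ 'p) set" where
  "L2_nonzero = {u \<in> L2_signals. L2_norm u \<noteq> 0}"


section \<open>Reset systems\<close>

definition flow_set :: "real ^ 'n ^ 'n \<Rightarrow> (real ^ 'n) set" where
  "flow_set M = {\<mu>. \<mu> \<bullet> (M *v \<mu>) \<ge> 0}"

definition jump_set :: "real ^ 'n ^ 'n \<Rightarrow> (real ^ 'n) set" where
  "jump_set M = {\<mu>. \<mu> \<bullet> (M *v \<mu>) < 0}"

text \<open>The Caratheodory (integrated) form of \<open>x' = A x + B u\<close> between \<open>a\<close> and \<open>b\<close>.\<close>

definition flows ::
  "real ^ 'n ^ 'n \<Rightarrow> real ^ 'p ^ 'n \<Rightarrow> (real \<Rightarrow> real ^ 'p) \<Rightarrow> (real \<Rightarrow> real ^ 'n) \<Rightarrow> real \<Rightarrow> real \<Rightarrow> bool" where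
  "flows A B u x a b \<longleftrightarrow> ((\<lambda>t. A *v x t + B *v u t) has_integral (x b - x a)) {a..b}"

text \<open>
  A reset at time \<open>t\<close> from state \<open>\<mu>\<close> is triggered when flowing on from \<open>\<mu>\<close> leads at once into the
  jump set.  This covers every \<open>\<mu>\<close> in the jump set, which is open, and those states on its boundary
  from which the flow leaves the flow set.  The boundary states are needed: \<open>x\<close> is left continuous,
  so a state in the open jump set at time \<open>t\<close> would be preceded by such states on a whole interval,
  and resets from the jump set itself could never be isolated in time.
\<close>

definition reset_triggered ::
  "real ^ 'n ^ 'n \<Rightarrow> real ^ 'p ^ 'n \<Rightarrow> real ^ 'n ^ 'n \<Rightarrow> (real \<Rightarrow> real ^ 'p) \<Rightarrow> real \<Rightarrow> real ^ 'n \<Rightarrow> bool" where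
  "reset_triggered A B M u t \<mu> \<longleftrightarrow>
     (\<exists>\<xi>. \<xi> t = \<mu> \<and> (\<forall>s>t. flows A B u \<xi> t s) \<and> (\<forall>\<epsilon>>0. \<exists>s\<in>{t<..<t + \<epsilon>}. \<xi> s \<in> jump_set M))"

text \<open>
  State trajectories \<open>x\<close> with set of reset times \<open>T\<close>.  The value \<open>x t\<close> at a reset time is the
  one before the reset; the one after it is the right limit.  Each time is followed by
  a reset-free interval, but the reset times may accumulate from the left: Zeno behavior is excluded
  only by the standing assumption below.
\<close>

definition state_trajectory ::
  "real ^ 'n ^ 'n \<Rightarrow> real ^ 'p ^ 'n \<Rightarrow> real ^ 'n ^ 'n \<Rightarrow> real ^ 'n ^ 'n \<Rightarrow>
   (real \<Rightarrow> real ^ 'p) \<Rightarrow> (real \<Rightarrow> real ^ 'n) \<Rightarrow> real set \<Rightarrow> bool" where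
  "state_trajectory A B R M u x T \<longleftrightarrow>
     x 0 = 0 \<and>
     T \<subseteq> {0..} \<and>
     (\<forall>t\<ge>0. \<exists>\<epsilon>>0. T \<inter> {t<..<t + \<epsilon>} = {}) \<and>
     (\<forall>t>0. (x \<longlongrightarrow> x t) (at_left t)) \<and>
     (\<forall>t\<ge>0. t \<notin> T \<longrightarrow> x t \<in> flow_set M) \<and>
     (\<forall>a b. 0 \<le> a \<and> a < b \<and> T \<inter> {a..b} = {} \<longrightarrow> flows A B u x a b) \<and>
     (\<forall>t\<in>T. reset_triggered A B M u t (x t) \<and> (x \<longlongrightarrow> R *v x t) (at_right t))"

definition reset_system ::
  "real ^ 'n ^ 'n \<Rightarrow> real ^ 'p ^ 'n \<Rightarrow> real ^ 'n ^ 'p \<Rightarrow> real ^ 'p ^ 'p \<Rightarrow> real ^ 'n ^ 'n \<Rightarrow> real ^ 'n ^ 'n \<Rightarrow>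
   (real \<Rightarrow> real ^ 'p) \<Rightarrow> (real \<Rightarrow> real ^ 'p) set" where
  "reset_system A B C D R M u =
     {y. \<exists>x T. state_trajectory A B R M u x T \<and> (\<forall>t\<ge>0. y t = C *v x t + D *v u t)}"

definition standing_assumption ::
  "real ^ 'n ^ 'n \<Rightarrow> real ^ 'p ^ 'n \<Rightarrow> real ^ 'n ^ 'p \<Rightarrow> real ^ 'p ^ 'p \<Rightarrow> real ^ 'n ^ 'n \<Rightarrow> real ^ 'n ^ 'n \<Rightarrow> bool" where
  "standing_assumption A B C D R M \<longleftrightarrow>
     (\<forall>u\<in>L2_signals. \<forall>x T. state_trajectory A B R M u x T \<longrightarrow>
        (\<forall>\<tau>. finite (T \<inter> {0..\<tau>})) \<and>
        x \<in> L2_signals \<and>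
        (\<lambda>t. C *v x t + D *v u t) \<in> L2_signals \<and>
        (x \<longlongrightarrow> 0) at_top)"


section \<open>Scaled graphs\<close>

text \<open>From here on a system is any set-valued map on signals.\<close>

definition gain :: "(real \<Rightarrow> real ^ 'p) \<Rightarrow> (real \<Rightarrow> real ^ 'p) \<Rightarrow> real" where
  "gain u y = L2_norm y / L2_norm u"

definition phase :: "(real \<Rightarrow> real ^ 'p) \<Rightarrow> (real \<Rightarrow> real ^ 'p) \<Rightarrow> real" where
  "phase u y = (if L2_norm y = 0 then 0 else arccos (L2_inner u y / (L2_norm u * L2_norm y)))"

definition sg_points ::
  "((real \<Rightarrow> real ^ 'p) \<Rightarrow> (real \<Rightarrow> real ^ 'p) set) \<Rightarrow> (real \<Rightarrow> real ^ 'p) \<Rightarrow> complex set" where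
  "sg_points \<R> u = (\<Union>y\<in>\<R> u. {rcis (gain u y) (phase u y), rcis (gain u y) (- phase u y)})"

definition samples ::
  "((real \<Rightarrow> real ^ 'p) \<Rightarrow> (real \<Rightarrow> real ^ 'p) set) \<Rightarrow> (real \<Rightarrow> real ^ 'p) set \<Rightarrow> complex set" where
  "samples \<R> U = (\<Union>u\<in>U. sg_points \<R> u)"

definition scaled_graph ::
  "((real \<Rightarrow> real ^ 'p) \<Rightarrow> (real \<Rightarrow> real ^ 'p) set) \<Rightarrow> complex set" where
  "scaled_graph \<R> = (\<Union>u\<in>L2_nonzero. sg_points \<R> u)"


section \<open>Quadratic dissipativity\<close>

text \<open>Rows and columns of a Kronecker product are indexed by pairs (block, position in the block).\<close>

definition kronecker :: "real ^ 'b ^ 'a \<Rightarrow> real ^ 'd ^ 'c \<Rightarrow> real ^ ('b \<times> 'd) ^ ('a \<times> 'c)" where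
  "kronecker P Q = (\<chi> i j. P $ fst i $ fst j * Q $ snd i $ snd j)"

definition stack :: "real ^ 'p \<Rightarrow> real ^ 'p \<Rightarrow> real ^ (2 \<times> 'p)" where
  "stack y u = (\<chi> i. (vector [y, u] :: (real ^ 'p) ^ 2) $ fst i $ snd i)"

definition dissipation_set ::
  "((real \<Rightarrow> real ^ 'p) \<Rightarrow> (real \<Rightarrow> real ^ 'p) set) \<Rightarrow> (real ^ 2 ^ 2) set" where
  "dissipation_set \<R> =
     {P. transpose P = P \<and>
         (\<forall>u\<in>L2_signals. \<forall>y\<in>\<R> u.
            (LINT t|lebesgue_on {0..}.
               stack (y t) (u t) \<bullet> (kronecker P (mat 1 :: real ^ 'p ^ 'p) *v stack (y t) (u t))) \<ge> 0)}"

text \<open>The Hermitian form is real for symmetric \<open>P\<close>, so taking its real part loses nothing.\<close>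

definition quad_region :: "real ^ 2 ^ 2 \<Rightarrow> complex set" where
  "quad_region P =
     {z. let v = (vector [z, 1] :: complex ^ 2) in
         Re (\<Sum>i\<in>UNIV. \<Sum>j\<in>UNIV. cnj (v $ i) * of_real (P $ i $ j) * v $ j) \<ge> 0}"


section \<open>Hyperbolic convexity\<close>

definition upper_half :: "complex set" where
  "upper_half = {z. Im z \<ge> 0}"

text \<open>
  On a half circle centered on the real axis the real part determines the point, so the
  arc between two points consists of the points whose real part lies between theirs.
\<close>

definition arc_min :: "complex \<Rightarrow> complex \<Rightarrow> complex set" where
  "arc_min z1 z2 =
     (if Re z1 = Re z2 then closed_segment z1 z2
      else {z \<in> upper_half. Re z \<in> closed_segment (Re z1) (Re z2) \<and>
              (\<exists>c r :: real. {z, z1, z2} \<subseteq> sphere (of_real c) r)})"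

definition h_convex :: "complex set \<Rightarrow> bool" where
  "h_convex S \<longleftrightarrow> S \<subseteq> upper_half \<and> (\<forall>z1\<in>S. \<forall>z2\<in>S. arc_min z1 z2 \<subseteq> S)"

text \<open>The hull of a set that is symmetric about the real axis.\<close>

definition h_hull :: "complex set \<Rightarrow> complex set" where
  "h_hull S = (h_convex hull (S \<inter> upper_half)) \<union> cnj ` (h_convex hull (S \<inter> upper_half))"

end

theory Submission
  imports Defs
begin

text \<open>
  For a symmetric matrix \<open>P\<close> the region \<open>quad_region P\<close> consists of the \<open>z\<close> with
  \<open>P\<^sub>1\<^sub>1 |z|\<^sup>2 + 2 P\<^sub>1\<^sub>2 Re z + P\<^sub>2\<^sub>2 \<ge> 0\<close>.  Two facts about this inequality prove the theorem.

  It is what dissipativity says about a point of the scaled graph.  If \<open>z\<close> comes from the input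
  \<open>u\<close> and the output \<open>y\<close>, then \<open>|z|\<^sup>2 = \<langle>y, y\<rangle> / \<langle>u, u\<rangle>\<close> and \<open>Re z = \<langle>u, y\<rangle> / \<langle>u, u\<rangle>\<close>, so the left
  side is the dissipation integral of \<open>P\<close> divided by \<open>\<langle>u, u\<rangle>\<close>.  Hence every sample lies in
  \<open>quad_region P\<close> for every \<open>P\<close> in the dissipation set (\<open>sg_points_subset_quad_region\<close>).

  It is also preserved along hyperbolic geodesics: on a circle centered on the real axis \<open>|z|\<^sup>2\<close> is
  an affine function of \<open>Re z\<close>, and therefore so is the left side; on a vertical segment the left
  side is affine in \<open>(Im z)\<^sup>2\<close>.  So the upper half of \<open>quad_region P\<close> is h-convex
  (\<open>h_convex_quad_region\<close>), and as \<open>quad_region P\<close> is symmetric about the real axis it contains the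
  hull of each symmetric set that it contains.

  Together, the hull of the samples lies in every over-bound that quadratic dissipativity can
  give; an over-bound that equals this hull is the least one.
\<close>

section \<open>Square integrable signals\<close>

lemma L2_inner_integrable:
  assumes "u \<in> L2_signals" "y \<in> L2_signals"
  shows "integrable (lebesgue_on {0..}) (\<lambda>t. u t \<bullet> y t)"
proof (rule Bochner_Integration.integrable_bound)
  show "integrable (lebesgue_on {0..}) (\<lambda>t. u t \<bullet> u t + y t \<bullet> y t)"
    using assms by (simp add: L2_signals_def)
  show "(\<lambda>t. u t \<bullet> y t) \<in> borel_measurable (lebesgue_on {0..})"
    using assms by (auto simp: L2_signals_def)
  have "\<bar>a \<bullet> b\<bar> \<le> a \<bullet> a + b \<bullet> b" for a b :: "real ^ 'p"
  proof -
    have "0 \<le> (a + b) \<bullet> (a + b)" "0 \<le> (a - b) \<bullet> (a - b)" "0 \<le> a \<bullet> a" "0 \<le> b \<bullet> b"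
      by simp_all
    then show ?thesis
      by (simp only: inner_add_left inner_add_right inner_diff_left inner_diff_right
          inner_commute[of b a])
  qed
  then show "AE t in lebesgue_on {0..}. norm (u t \<bullet> y t) \<le> norm (u t \<bullet> u t + y t \<bullet> y t)"
    by (intro AE_I2) (auto intro: order_trans[OF _ abs_ge_self])
qed

lemma L2_inner_self_nonneg: "0 \<le> L2_inner u u"
  by (simp add: L2_inner_def)

lemma L2_norm_squared: "(L2_norm u)\<^sup>2 = L2_inner u u"
  by (simp add: L2_norm_def L2_inner_self_nonneg)

lemma L2_norm_nonneg: "0 \<le> L2_norm u"
  by (simp add: L2_norm_def L2_inner_self_nonneg)

lemma L2_Cauchy_Schwarz:
  assumes u: "u \<in> L2_nonzero" and y: "y \<in> L2_signals"
  shows "\<bar>L2_inner u y\<bar> \<le> L2_norm u * L2_norm y"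
proof -
  have uL: "u \<in> L2_signals" using u by (simp add: L2_nonzero_def)
  have pos: "0 < L2_inner u u"
    using u L2_inner_self_nonneg[of u] by (simp add: L2_nonzero_def L2_norm_def)
  note int = L2_inner_integrable[OF uL uL] L2_inner_integrable[OF uL y] L2_inner_integrable[OF y y]
  \<comment> \<open>\<open>l u\<close> is the orthogonal projection of \<open>y\<close> onto the line through \<open>u\<close>.\<close>
  define l where "l = L2_inner u y / L2_inner u u"
  have "0 \<le> (LINT t|lebesgue_on {0..}. (y t - l *\<^sub>R u t) \<bullet> (y t - l *\<^sub>R u t))"
    by simp
  also have "\<dots> = (LINT t|lebesgue_on {0..}. y t \<bullet> y t - 2 * l * (u t \<bullet> y t) + l\<^sup>2 * (u t \<bullet> u t))"
    by (rule Bochner_Integration.integral_cong)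
       (auto simp: inner_diff_left inner_diff_right inner_commute power2_eq_square algebra_simps)
  also have "\<dots> = L2_inner y y - 2 * l * L2_inner u y + l\<^sup>2 * L2_inner u u"
    unfolding L2_inner_def using int by simp
  also have "\<dots> = L2_inner y y - (L2_inner u y)\<^sup>2 / L2_inner u u"
    using pos by (simp add: l_def power2_eq_square field_simps)
  finally have "(L2_inner u y)\<^sup>2 \<le> (L2_norm u * L2_norm y)\<^sup>2"
    using pos by (simp add: power_mult_distrib L2_norm_squared field_simps)
  then show ?thesis
    by (simp add: abs_le_square_iff[symmetric] abs_mult L2_norm_nonneg)
qed


section \<open>Points of the scaled graph in Cartesian coordinates\<close>

text \<open>
  Since \<open>gain u y * cos (phase u y) = \<langle>u, y\<rangle> / \<langle>u, u\<rangle>\<close>, the polar form of the scaled graph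
  hides quantities that are quadratic in the signals.  Cauchy-Schwarz is what makes the cosine cancel the
  arccosine, and for an output of norm zero it gives \<open>\<langle>u, y\<rangle> = 0\<close>.
\<close>

lemma gain_cos_phase:
  assumes u: "u \<in> L2_nonzero" and y: "y \<in> L2_signals"
  shows "gain u y * cos (phase u y) = L2_inner u y / L2_inner u u"
proof -
  have pos: "0 < L2_norm u"
    using u L2_norm_nonneg[of u] by (simp add: L2_nonzero_def)
  note CS = L2_Cauchy_Schwarz[OF u y]
  show ?thesis
  proof (cases "L2_norm y = 0")
    case True
    then show ?thesis using CS by (simp add: gain_def)
  next
    case False
    then have "0 < L2_norm u * L2_norm y"
      using pos L2_norm_nonneg[of y] by simp
    then have "\<bar>L2_inner u y / (L2_norm u * L2_norm y)\<bar> \<le> 1"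
      using CS by (simp add: abs_divide)
    then have "cos (phase u y) = L2_inner u y / (L2_norm u * L2_norm y)"
      using False by (simp add: phase_def cos_arccos_abs)
    then show ?thesis
      using False pos by (simp add: gain_def L2_norm_squared[symmetric] power2_eq_square)
  qed
qed

lemma sg_points_cartesian:
  assumes u: "u \<in> L2_nonzero" and S: "S u \<subseteq> L2_signals" and z: "z \<in> sg_points S u"
  obtains y where "y \<in> S u" "Re z = L2_inner u y / L2_inner u u"
    "(cmod z)\<^sup>2 = L2_inner y y / L2_inner u u"
proof -
  obtain y where y: "y \<in> S u"
    and z: "z = rcis (gain u y) (phase u y) \<or> z = rcis (gain u y) (- phase u y)"
    using z by (auto simp: sg_points_def)
  have "Re z = gain u y * cos (phase u y)"
    using z by auto
  moreover have "(cmod z)\<^sup>2 = L2_inner y y / L2_inner u u"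
    using z by (auto simp: gain_def power_divide L2_norm_squared)
  ultimately show ?thesis
    using that[OF y] gain_cos_phase[OF u] y S by auto
qed


section \<open>Quadratic forms\<close>

lemma mem_quad_region_iff:
  "z \<in> quad_region P \<longleftrightarrow> 0 \<le> P$1$1 * (cmod z)\<^sup>2 + (P$1$2 + P$2$1) * Re z + P$2$2"
  unfolding cmod_power2
  by (simp add: quad_region_def Let_def sum_2 power2_eq_square algebra_simps)

text \<open>The Kronecker factor \<open>I\<^sub>p\<close> makes the matrix act on whole blocks.\<close>

lemma stack_kronecker_mat_1:
  fixes y u :: "real ^ 'p"
  shows "stack y u \<bullet> (kronecker P (mat 1 :: real ^ 'p ^ 'p) *v stack y u) =
    P$1$1 * (y \<bullet> y) + (P$1$2 + P$2$1) * (u \<bullet> y) + P$2$2 * (u \<bullet> u)"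
proof -
  define v :: "(real ^ 'p) ^ 2" where "v = vector [y, u]"
  have "(kronecker P (mat 1 :: real ^ 'p ^ 'p) *v stack y u) $ k =
      (\<Sum>b\<in>UNIV. P $ fst k $ b * v $ b $ snd k)" for k
  proof -
    have "(kronecker P (mat 1 :: real ^ 'p ^ 'p) *v stack y u) $ k =
        (\<Sum>b\<in>UNIV. \<Sum>j\<in>UNIV. P $ fst k $ b * (if snd k = j then 1 else 0) * v $ b $ j)"
      by (simp add: matrix_vector_mult_def kronecker_def stack_def v_def mat_def
          UNIV_Times_UNIV[symmetric] sum.cartesian_product case_prod_unfold del: UNIV_Times_UNIV)
    also have "\<dots> = (\<Sum>b\<in>UNIV. \<Sum>j\<in>UNIV. if snd k = j then P $ fst k $ b * v $ b $ j else 0)"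
      by (intro sum.cong refl) auto
    finally show ?thesis by simp
  qed
  then have "stack y u \<bullet> (kronecker P (mat 1 :: real ^ 'p ^ 'p) *v stack y u) =
      (\<Sum>a\<in>UNIV. \<Sum>i\<in>UNIV. v$a$i * (\<Sum>b\<in>UNIV. P$a$b * v$b$i))"
    by (simp add: inner_vec_def stack_def v_def sum.cartesian_product case_prod_unfold)
  also have "\<dots> = (\<Sum>a\<in>UNIV. \<Sum>b\<in>UNIV. P$a$b * (v$a \<bullet> v$b))"
    by (simp add: sum_2 inner_vec_def sum.distrib sum_distrib_left algebra_simps)
  finally show ?thesis
    by (simp add: sum_2 v_def inner_commute algebra_simps)
qed

lemma dissipation_set_L2_inner:
  assumes P: "P \<in> dissipation_set S" and u: "u \<in> L2_signals" and y: "y \<in> S u" "y \<in> L2_signals"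
  shows "0 \<le> P$1$1 * L2_inner y y + (P$1$2 + P$2$1) * L2_inner u y + P$2$2 * L2_inner u u"
proof -
  note int = L2_inner_integrable[OF u u] L2_inner_integrable[OF u y(2)]
    L2_inner_integrable[OF y(2) y(2)]
  have "0 \<le> (LINT t|lebesgue_on {0..}.
      P$1$1 * (y t \<bullet> y t) + (P$1$2 + P$2$1) * (u t \<bullet> y t) + P$2$2 * (u t \<bullet> u t))"
    using P u y(1) by (auto simp: dissipation_set_def stack_kronecker_mat_1)
  then show ?thesis
    unfolding L2_inner_def using int by simp
qed

lemma sg_points_subset_quad_region:
  assumes P: "P \<in> dissipation_set S" and u: "u \<in> L2_nonzero" and S: "S u \<subseteq> L2_signals"
  shows "sg_points S u \<subseteq> quad_region P"
proof
  fix z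
  assume "z \<in> sg_points S u"
  then obtain y where y: "y \<in> S u" and Re: "Re z = L2_inner u y / L2_inner u u"
    and cmod: "(cmod z)\<^sup>2 = L2_inner y y / L2_inner u u"
    using sg_points_cartesian[where S = S] u S by blast
  have uL: "u \<in> L2_signals" and pos: "0 < L2_inner u u"
    using u L2_inner_self_nonneg[of u] by (auto simp: L2_nonzero_def L2_norm_def)
  have "y \<in> L2_signals" using y S by blast
  from dissipation_set_L2_inner[OF P uL y this] pos
  have "0 \<le> (P$1$1 * L2_inner y y + (P$1$2 + P$2$1) * L2_inner u y + P$2$2 * L2_inner u u) /
      L2_inner u u"
    by simp
  also have "\<dots> = P$1$1 * (cmod z)\<^sup>2 + (P$1$2 + P$2$1) * Re z + P$2$2"
    unfolding Re cmod using pos by (simp add: add_divide_distrib)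
  finally show "z \<in> quad_region P"
    by (simp add: mem_quad_region_iff)
qed


section \<open>Hyperbolic convexity of quadratic regions\<close>

lemma affine_nonneg_on_segment:
  fixes a b :: real
  assumes "t \<in> closed_segment x y" "0 \<le> a * x + b" "0 \<le> a * y + b"
  shows "0 \<le> a * t + b"
proof -
  obtain s where s: "0 \<le> s" "s \<le> 1" "t = (1 - s) * x + s * y"
    using assms(1) by (auto simp: closed_segment_def)
  have "a * t + b = (1 - s) * (a * x + b) + s * (a * y + b)"
    unfolding s(3) by (simp add: algebra_simps)
  with s assms show ?thesis by simp
qed

lemma cmod_squared_on_real_centered_sphere:
  assumes "z \<in> sphere (of_real c) r"
  shows "(cmod z)\<^sup>2 = 2 * c * Re z + (r\<^sup>2 - c\<^sup>2)"
proof -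
  have "(cmod (of_real c - z))\<^sup>2 = r\<^sup>2"
    using assms by (simp add: dist_norm)
  then show ?thesis
    unfolding cmod_power2 by (simp add: power2_eq_square algebra_simps)
qed

text \<open>
  Along an arc the quadratic form is affine in one real parameter that stays between its values at
  the end points: in \<open>Re z\<close> on a half circle and in \<open>(Im z)\<^sup>2\<close> on a vertical segment.  An affine
  function that is nonnegative at both ends is nonnegative in between, whatever the signature of
  \<open>P\<close>.
\<close>

lemma h_convex_quad_region: "h_convex (quad_region P \<inter> upper_half)"
  unfolding h_convex_def
proof (intro conjI ballI subsetI)
  fix z1 z2 z
  assume z1: "z1 \<in> quad_region P \<inter> upper_half" and z2: "z2 \<in> quad_region P \<inter> upper_half"
    and z: "z \<in> arc_min z1 z2"
  let ?a = "P$1$1" and ?b = "P$1$2 + P$2$1" and ?d = "P$2$2"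
  show "z \<in> quad_region P \<inter> upper_half"
  proof (cases "Re z1 = Re z2")
    case True
    then have "z \<in> closed_segment z1 z2"
      using z by (simp add: arc_min_def)
    then obtain s where s: "0 \<le> s" "s \<le> 1" "z = (1 - s) *\<^sub>R z1 + s *\<^sub>R z2"
      by (auto simp: closed_segment_def)
    have Re: "Re z = Re z1"
      using True by (simp add: s(3) algebra_simps)
    have Im: "Im z \<in> closed_segment (Im z1) (Im z2)"
      using s by (auto simp: closed_segment_def)
    have up: "0 \<le> Im z1" "0 \<le> Im z2"
      using z1 z2 by (auto simp: upper_half_def)
    \<comment> \<open>Squaring is monotone on the nonnegative reals, so it preserves betweenness.\<close>
    have Im2: "(Im z)\<^sup>2 \<in> closed_segment ((Im z1)\<^sup>2) ((Im z2)\<^sup>2)"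
      using Im up by (auto simp: closed_segment_eq_real_ivl power_mono split: if_splits)
    have "0 \<le> ?a * (Im z)\<^sup>2 + (?a * (Re z1)\<^sup>2 + ?b * Re z1 + ?d)"
      by (rule affine_nonneg_on_segment[OF Im2])
         (use z1 z2 True in \<open>simp_all add: mem_quad_region_iff cmod_power2 algebra_simps\<close>)
    then have "z \<in> quad_region P"
      by (simp add: mem_quad_region_iff cmod_power2 Re algebra_simps)
    moreover have "z \<in> upper_half"
      using Im up by (auto simp: upper_half_def closed_segment_eq_real_ivl split: if_splits)
    ultimately show ?thesis by simp
  next
    case False
    then obtain c r where up: "z \<in> upper_half"
      and Re: "Re z \<in> closed_segment (Re z1) (Re z2)"
      and on: "z \<in> sphere (of_real c) r" "z1 \<in> sphere (of_real c) r" "z2 \<in> sphere (of_real c) r"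
      using z unfolding arc_min_def by auto
    note cmod = on[THEN cmod_squared_on_real_centered_sphere]
    have "0 \<le> (?a * (2 * c) + ?b) * Re z + (?a * (r\<^sup>2 - c\<^sup>2) + ?d)"
      by (rule affine_nonneg_on_segment[OF Re])
         (use z1 z2 in \<open>simp_all add: mem_quad_region_iff cmod algebra_simps\<close>)
    with up show ?thesis
      by (simp add: mem_quad_region_iff cmod algebra_simps)
  qed
qed simp

lemma h_hull_subset_quad_region:
  assumes "Z \<subseteq> quad_region P"
  shows "h_hull Z \<subseteq> quad_region P"
proof -
  have "h_convex hull (Z \<inter> upper_half) \<subseteq> quad_region P \<inter> upper_half"
    using assms h_convex_quad_region by (intro hull_minimal) auto
  moreover have "cnj z \<in> quad_region P" if "z \<in> quad_region P" for z
    using that by (simp add: mem_quad_region_iff)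
  ultimately show ?thesis
    by (auto simp: h_hull_def)
qed


section \<open>Minimality of the over-bound\<close>

text \<open>
  The standing assumption speaks of \<open>C x + D u\<close>, with which an output has to agree at nonnegative
  times only; membership in \<open>L2_signals\<close> depends on no other values.
\<close>

lemma reset_system_L2:
  assumes "standing_assumption A B C D R M" "u \<in> L2_signals"
  shows "reset_system A B C D R M u \<subseteq> L2_signals"
proof
  fix y
  assume "y \<in> reset_system A B C D R M u"
  then obtain x T where traj: "state_trajectory A B R M u x T"
    and y: "\<And>t. 0 \<le> t \<Longrightarrow> y t = C *v x t + D *v u t"
    by (auto simp: reset_system_def)
  have "(\<lambda>t. C *v x t + D *v u t) \<in> L2_signals"
    using assms traj unfolding standing_assumption_def by blast
  moreover have "y \<in> borel_measurable (lebesgue_on {0..}) \<longleftrightarrow>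
      (\<lambda>t. C *v x t + D *v u t) \<in> borel_measurable (lebesgue_on {0..})"
    by (rule measurable_cong) (simp add: y)
  moreover have "integrable (lebesgue_on {0..}) (\<lambda>t. y t \<bullet> y t) \<longleftrightarrow>
      integrable (lebesgue_on {0..}) (\<lambda>t. (C *v x t + D *v u t) \<bullet> (C *v x t + D *v u t))"
    by (rule Bochner_Integration.integrable_cong) (simp_all add: y)
  ultimately show "y \<in> L2_signals"
    by (simp add: L2_signals_def)
qed

theorem corollary1:
  fixes A :: "real ^ 'n ^ 'n" and B :: "real ^ 'p ^ 'n"
    and C :: "real ^ 'n ^ 'p" and D :: "real ^ 'p ^ 'p"
    and R :: "real ^ 'n ^ 'n" and M :: "real ^ 'n ^ 'n"
    and \<Pi>s :: "(real ^ 2 ^ 2) set"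
    and U :: "(real \<Rightarrow> real ^ 'p) set"
    and S\<^sub>S\<^sub>G :: "complex set"
  assumes "transpose M = M"
    and "standing_assumption A B C D R M"
    and "\<Pi>s \<subseteq> dissipation_set (reset_system A B C D R M)"
    and "S\<^sub>S\<^sub>G = (\<Inter>P\<in>\<Pi>s. quad_region P)"
    and "U \<subseteq> L2_nonzero"
    and "h_hull (samples (reset_system A B C D R M) U) = S\<^sub>S\<^sub>G"
  shows "\<forall>\<Pi>s'. \<Pi>s' \<subseteq> dissipation_set (reset_system A B C D R M) \<longrightarrow>
           S\<^sub>S\<^sub>G \<subseteq> (\<Inter>P\<in>\<Pi>s'. quad_region P)"
proof (intro allI impI INT_greatest)
  fix \<Pi>s' P
  assume "\<Pi>s' \<subseteq> dissipation_set (reset_system A B C D R M)" "P \<in> \<Pi>s'"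
  then have P: "P \<in> dissipation_set (reset_system A B C D R M)"
    by blast
  have "sg_points (reset_system A B C D R M) u \<subseteq> quad_region P" if "u \<in> U" for u
  proof -
    have u: "u \<in> L2_nonzero" "u \<in> L2_signals"
      using that assms(5) by (auto simp: L2_nonzero_def)
    show ?thesis
      using sg_points_subset_quad_region[OF P u(1) reset_system_L2[OF assms(2) u(2)]] .
  qed
  then have "samples (reset_system A B C D R M) U \<subseteq> quad_region P"
    by (auto simp: samples_def)
  then have "h_hull (samples (reset_system A B C D R M) U) \<subseteq> quad_region P"
    by (rule h_hull_subset_quad_region)
  then show "S\<^sub>S\<^sub>G \<subseteq> quad_region P"
    using assms(6) by simp
qed

end
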